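(* Let $m\ge2$, let $0\le q\le m\le 2p$ be integers, and let $T=\{t_i\}_{i\in\mathbb{Z}}$ be a strictly increasing knot sequence of $\mathbb{R}$ with $|t_i|\to+\infty$ as $|i|\to+\infty$. For every $i\in\mathbb{Z}$, the minimization problem $$(\overline M_i)\qquad \min\{\Vert a\Vert_1\;:\;a\in\mathbb{R}^{2p+1},\ W_ia=b_i\}$$ has at least one solution (minimizer). In general the solution is not unique (that is, uniqueness fails for some instances of the data $m,p,q,T,i$).
   Context: For $j\in\mathbb{Z}$, $M_j$ is the B-spline of degree $m-2$ with knots $t_{j-m+1},\ldots,t_j$ (support $\Sigma_j=[t_{j-m+1},t_j]$), normalized by $\int_{\mathbb{R}}M_j=1$, and $\mu_j^{(r)}=\int_{\mathbb{R}}x^rM_j(x)\,dx$ are its moments. For $0\le r\le m$, $\theta_i^{(r)}=\sigma_r(T_i)/\binom mr$, where $\sigma_r(T_i)$ is the $r$-th elementary symmetric function of the $m$ knots $T_i=\{t_{i-m+1},\ldots,t_i\}$ (with $\sigma_0=1$). Vectors $a\in\mathbb{R}^{2p+1}$ are indexed as $(a(s))_{-p\le s\le p}$, and $\Vert a\Vert_1=\sum_s|a(s)|$. The matrix $W_i\in\mathbb{R}^{(q+1)\times(2p+1)}$ has entries $W_i(r,s)=\mu_{i+s}^{(r)}$ ($0\le r\le q$, $-p\le s\le p$), and $b_i\in\mathbb{R}^{q+1}$ has components $b_i(r)=\theta_i^{(r)}$, $0\le r\le q$. (The constraints $W_ia_i=b_i$ for all $i$ express that the integral quasi-interpolant $G_{p,q}f=\sum_i\big(\sum_{s=-p}^pa_i(s)\int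 M_{i+s}f\big)B_i$, with $B_i$ the degree $m$ B-splines, reproduces polynomials of degree at most $q$.) *)

theory Defs
  imports "HOL-Analysis.Analysis"
begin

definition knot_sequence :: "(int \<Rightarrow> real) \<Rightarrow> bool" where
  "knot_sequence t \<longleftrightarrow> strict_mono t \<and>
     filterlim (\<lambda>i. \<bar>t i\<bar>) at_top (filtercomap (abs :: int \<Rightarrow> int) at_top)"

text \<open>Cox--de Boor recursion: \<open>bspline t k j\<close> is the B-spline of degree \<open>k\<close> whose knots are
  \<open>t j, \<dots>, t (j + k + 1)\<close>. It is right-continuous at the knots, which matters only for \<open>k = 0\<close>
  and does not affect integrals.\<close>

fun bspline :: "(int \<Rightarrow> real) \<Rightarrow> nat \<Rightarrow> int \<Rightarrow> real \<Rightarrow> real" where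
  "bspline t 0 j x = indicator {t j..<t (j + 1)} x"
| "bspline t (Suc k) j x =
     (x - t j) / (t (j + int k + 1) - t j) * bspline t k j x
   + (t (j + int k + 2) - x) / (t (j + int k + 2) - t (j + 1)) * bspline t k (j + 1) x"

text \<open>For \<open>m \<ge> 2\<close>, \<open>M_spline t m j\<close> has the \<open>m\<close> knots \<open>t (j - m + 1), \<dots>, t j\<close>, degree
  \<open>m - 2\<close>, and integral 1.\<close>

definition M_spline :: "(int \<Rightarrow> real) \<Rightarrow> nat \<Rightarrow> int \<Rightarrow> real \<Rightarrow> real" where
  "M_spline t m j x =
     bspline t (m - 2) (j - int m + 1) x / (LINT y|lborel. bspline t (m - 2) (j - int m + 1) y)"

definition moment :: "(int \<Rightarrow> real) \<Rightarrow> nat \<Rightarrow> nat \<Rightarrow> int \<Rightarrow> real" where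
  "moment t m r j = (LINT x|lborel. x ^ r * M_spline t m j x)"

text \<open>Elementary symmetric function of degree \<open>r\<close> in the variables \<open>t k\<close>, \<open>k \<in> I\<close>.\<close>

definition elem_sym :: "nat \<Rightarrow> 'i set \<Rightarrow> ('i \<Rightarrow> real) \<Rightarrow> real" where
  "elem_sym r I t = (\<Sum>S | S \<subseteq> I \<and> card S = r. \<Prod>k\<in>S. t k)"

definition theta :: "(int \<Rightarrow> real) \<Rightarrow> nat \<Rightarrow> nat \<Rightarrow> int \<Rightarrow> real" where
  "theta t m r i = elem_sym r {i - int m + 1..i} t / real (m choose r)"

text \<open>A vector in dimension \<open>2p + 1\<close> is a function on \<open>{-p..p}\<close>, extensional so that equality
  of vectors is equality of functions.\<close>

definition vecs :: "nat \<Rightarrow> (int \<Rightarrow> real) set" where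
  "vecs p = {- int p..int p} \<rightarrow>\<^sub>E UNIV"

definition norm1 :: "nat \<Rightarrow> (int \<Rightarrow> real) \<Rightarrow> real" where
  "norm1 p a = (\<Sum>s\<in>{- int p..int p}. \<bar>a s\<bar>)"

definition W :: "(int \<Rightarrow> real) \<Rightarrow> nat \<Rightarrow> int \<Rightarrow> nat \<Rightarrow> int \<Rightarrow> real" where
  "W t m i r s = moment t m r (i + s)"

definition feasible :: "(int \<Rightarrow> real) \<Rightarrow> nat \<Rightarrow> nat \<Rightarrow> nat \<Rightarrow> int \<Rightarrow> (int \<Rightarrow> real) set" where
  "feasible t m p q i =
     {a \<in> vecs p. \<forall>r\<le>q. (\<Sum>s\<in>{- int p..int p}. W t m i r s * a s) = theta t m r i}"

definition minimizer ::
    "(int \<Rightarrow> real) \<Rightarrow> nat \<Rightarrow> nat \<Rightarrow> nat \<Rightarrow> int \<Rightarrow> (int \<Rightarrow> real) \<Rightarrow> bool" where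
  "minimizer t m p q i a \<longleftrightarrow> is_arg_min (norm1 p) (\<lambda>b. b \<in> feasible t m p q i) a"

end

theory Submission
  imports Defs
begin

text \<open>Once some vector satisfies the constraints, a minimizer exists by compactness: the feasible
  set is closed, and only its part inside a cube matters (\<open>minimizer_exists\<close>). The
  substance is that the constraints are consistent. They are, whatever the right-hand side,
  because the rows of \<open>W\<close> are linearly independent (\<open>W_rows_independent\<close>).

  For this, the moment of order \<open>r\<close> of \<open>M_spline t m j\<close> is a positive multiple, depending only on
  \<open>m\<close> and \<open>r\<close>, of the divided difference of \<open>x ^ (r + m - 1)\<close> at the \<open>m\<close> knots of the spline
  (\<open>moment_eq_divdiff\<close>). A vanishing combination of the rows therefore yields a polynomial \<open>F\<close>,
  with terms of degrees \<open>m - 1, \<dots>, m - 1 + q\<close> only, whose divided differences vanish at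
  \<open>2 * p + 1\<close> consecutive windows of \<open>m\<close> knots. Hence \<open>F\<close> agrees with a polynomial of degree at
  most \<open>m - 2\<close> at \<open>2 * p + m\<close> points (\<open>divdiff_zero_imp_poly\<close>). Since
  \<open>2 * p + m > m - 1 + q\<close>, the two polynomials are equal, and as they have no degrees in common,
  \<open>F = 0\<close>.

  Uniqueness fails for \<open>q = 0\<close>: the only constraint says that the entries sum to \<open>1\<close>, so all unit
  vectors are minimizers.\<close>

section \<open>Divided differences\<close>

text \<open>The divided difference of \<open>f\<close> at the \<open>n + 1\<close> points \<open>t j, \<dots>, t (j + n)\<close>, which
  are meant to be distinct: the recursion divides by \<open>t (j + n) - t j\<close>.\<close>

fun divdiff :: "(int \<Rightarrow> real) \<Rightarrow> (real \<Rightarrow> real) \<Rightarrow> nat \<Rightarrow> int \<Rightarrow> real" where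
  "divdiff t f 0 j = f (t j)"
| "divdiff t f (Suc n) j =
     (divdiff t f n (j + 1) - divdiff t f n j) / (t (j + int n + 1) - t j)"

lemma divdiff_sum:
  "divdiff t (\<lambda>x. \<Sum>r\<in>R. c r * f r x) n j = (\<Sum>r\<in>R. c r * divdiff t (f r) n j)"
proof (induction n arbitrary: j)
  case (Suc n)
  show ?case
    by (simp add: Suc sum_divide_distrib[symmetric] sum_subtractf[symmetric] algebra_simps)
qed simp

lemma divdiff_diff_cmult:
  "divdiff t (\<lambda>x. f x - c * g x) n j = divdiff t f n j - c * divdiff t g n j"
proof (induction n arbitrary: j)
  case (Suc n)
  show ?case
    by (simp add: Suc diff_divide_distrib add_divide_distrib algebra_simps)
qed simp

text \<open>The Leibniz rule for a product with \<open>x\<close>, in the two forms that single out the first and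
  the last knot.\<close>

lemma divdiff_mult_x_first:
  assumes "strict_mono t"
  shows "divdiff t (\<lambda>x. x * f x) (Suc n) j
    = t j * divdiff t f (Suc n) j + divdiff t f n (j + 1)"
proof (induction n arbitrary: j)
  case 0
  have "t (j + 1) - t j > 0"
    using assms by (auto intro!: strict_monoD[of t])
  then show ?case
    by (simp add: divide_simps) (simp add: algebra_simps)
next
  case (Suc n)
  define a where "a = divdiff t f n (j + 1)"
  define b where "b = divdiff t f n (j + 1 + 1)"
  define c where "c = divdiff t f (Suc n) j"
  define d where "d = divdiff t f (Suc n) (j + 1)"
  have pos: "t (j + int (Suc n) + 1) - t j > 0" "t (j + 1 + int n + 1) - t (j + 1) > 0"
    using assms by (auto intro!: strict_monoD[of t])
  have d: "(t (j + 1 + int n + 1) - t (j + 1)) * d = b - a"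
    using pos(2) by (simp add: a_def b_def d_def)
  have "divdiff t (\<lambda>x. x * f x) (Suc (Suc n)) j
      = ((t (j + 1) * d + b) - (t j * c + a)) / (t (j + int (Suc n) + 1) - t j)"
    unfolding divdiff.simps(2)[of t _ "Suc n" j] Suc.IH a_def b_def c_def d_def ..
  also have "(t (j + 1) * d + b) - (t j * c + a)
      = t j * (d - c) + (t (j + int (Suc n) + 1) - t j) * d"
    using d by (simp add: algebra_simps)
  also have "\<dots> / (t (j + int (Suc n) + 1) - t j)
      = t j * ((d - c) / (t (j + int (Suc n) + 1) - t j)) + d"
    using pos(1) by (simp add: add_divide_distrib)
  finally show ?case
    unfolding divdiff.simps(2)[of t _ "Suc n" j] c_def d_def .
qed

lemma divdiff_mult_x_last:
  assumes "strict_mono t"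
  shows "divdiff t (\<lambda>x. x * f x) (Suc n) j
    = t (j + int n + 1) * divdiff t f (Suc n) j + divdiff t f n j"
proof -
  have "t (j + int n + 1) - t j > 0"
    using assms by (auto intro!: strict_monoD[of t])
  then have "(t (j + int n + 1) - t j) * divdiff t f (Suc n) j
      = divdiff t f n (j + 1) - divdiff t f n j"
    by simp
  then show ?thesis
    unfolding divdiff_mult_x_first[OF assms] by (simp only: algebra_simps)
qed

lemma divdiff_power_same:
  assumes "strict_mono t"
  shows "divdiff t (\<lambda>x. x ^ n) n j = 1"
proof (induction n arbitrary: j)
  case (Suc n)
  have "divdiff t (\<lambda>x. x ^ n) (Suc n) j = 0"
    by (simp add: Suc)
  then show ?case
    using divdiff_mult_x_first[OF assms, of "\<lambda>x. x ^ n" n j] Suc by simp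
qed simp

text \<open>If the divided differences of order \<open>n\<close> vanish on \<open>N\<close> consecutive windows of knots, then
  on the \<open>N + n\<close> knots involved the function agrees with a polynomial of degree less than \<open>n\<close>.
  The degree bound is stated by coefficients so that \<open>n = 0\<close> forces \<open>L = 0\<close>.\<close>

lemma divdiff_zero_imp_poly:
  assumes "strict_mono t"
    and "\<And>j. a \<le> j \<Longrightarrow> j < a + int N \<Longrightarrow> divdiff t f n j = 0"
  shows "\<exists>L. (\<forall>k\<ge>n. coeff L k = 0) \<and> (\<forall>j. a \<le> j \<longrightarrow> j < a + int (N + n) \<longrightarrow> f (t j) = poly L (t j))"
  using assms(2)
proof (induction n arbitrary: f N)
  case 0
  then show ?case
    by (intro exI[of _ 0]) auto
next
  case (Suc n)
  define c where "c = divdiff t f n a"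
  \<comment> \<open>The differences of order \<open>n\<close> are equal to a constant \<open>c\<close>, which subtracting \<open>c * x ^ n\<close>
    removes, so the induction hypothesis applies, with one window more.\<close>
  have step: "divdiff t f n (j + 1) = divdiff t f n j" if "a \<le> j" "j < a + int N" for j
  proof -
    have "t (j + int n + 1) - t j > 0"
      using assms(1) by (auto intro!: strict_monoD[of t])
    then show ?thesis
      using Suc.prems[OF that] by auto
  qed
  have "divdiff t f n (a + int k) = c" if "k < Suc N" for k
    using that
  proof (induction k)
    case (Suc k)
    then show ?case
      using step[of "a + int k"] by (simp add: algebra_simps)
  qed (simp add: c_def)
  note const = this
  have "divdiff t (\<lambda>x. f x - c * x ^ n) n j = 0" if "a \<le> j" "j < a + int (Suc N)" for j
    using const[of "nat (j - a)"] that
    by (simp add: divdiff_diff_cmult divdiff_power_same[OF assms(1)])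
  from Suc.IH[OF this] obtain L where L: "\<forall>k\<ge>n. coeff L k = 0"
    "\<forall>j. a \<le> j \<longrightarrow> j < a + int (Suc N + n) \<longrightarrow> f (t j) - c * t j ^ n = poly L (t j)"
    by blast
  show ?case
  proof (intro exI[of _ "L + monom c n"] conjI allI impI)
    fix k assume "Suc n \<le> k"
    then show "coeff (L + monom c n) k = 0"
      using L(1) by simp
  next
    fix j assume "a \<le> j" "j < a + int (N + Suc n)"
    then show "f (t j) = poly (L + monom c n) (t j)"
      using L(2)[rule_format, of j] by (simp add: poly_monom)
  qed
qed

section \<open>Moments of B-splines\<close>

lemma has_bochner_integral_power_Ico:
  fixes a b :: real
  assumes "a \<le> b"
  shows "has_bochner_integral lborel (\<lambda>x. x ^ r * indicator {a..<b} x)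
    ((b ^ Suc r - a ^ Suc r) / real (Suc r))"
proof -
  have "has_bochner_integral lborel (\<lambda>x. x ^ r * indicator {a..b} x)
    ((b ^ Suc r - a ^ Suc r) / real (Suc r))"
    using borel_integrable_atLeastAtMost[of a b "\<lambda>x. x ^ r"] integral_power[OF assms, of r]
    by (simp add: has_bochner_integral_iff ac_simps)
  moreover have "AE x in lborel. x ^ r * indicator {a..b} x = x ^ r * (indicator {a..<b} x :: real)"
    using AE_lborel_singleton[of b] by eventually_elim (auto simp: indicator_def)
  ultimately show ?thesis
    by (subst has_bochner_integral_cong_AE[symmetric]) auto
qed

lemma bspline_moment_base:
  assumes "strict_mono t"
  shows "has_bochner_integral lborel (\<lambda>x. x ^ r * bspline t 0 j x)
    ((t (j + 1) - t j) * (fact 0 * fact r / fact (r + 0 + 1))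
      * divdiff t (\<lambda>x. x ^ (r + 0 + 1)) (Suc 0) j)"
proof -
  have pos: "t (j + 1) - t j > 0"
    using assms by (auto intro!: strict_monoD[of t])
  have "(t (j + 1) - t j) * (fact 0 * fact r / fact (r + 0 + 1))
      * divdiff t (\<lambda>x. x ^ (r + 0 + 1)) (Suc 0) j
    = (t (j + 1) ^ Suc r - t j ^ Suc r) / real (Suc r)"
    using pos by simp
  then show ?thesis
    using has_bochner_integral_power_Ico[of "t j" "t (j + 1)" r] pos by simp
qed

text \<open>This is the Peano kernel representation of the divided difference of \<open>x ^ (r + k + 1)\<close>,
  whose derivative of order \<open>k + 1\<close> is a multiple of \<open>x ^ r\<close>.
  The Cox--de Boor recursion expresses the moments of degree \<open>k + 1\<close> by those of degree \<open>k\<close>, and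
  the two forms of the Leibniz rule show that the right-hand side obeys the same recursion.\<close>

lemma bspline_moment:
  assumes "strict_mono t"
  shows "has_bochner_integral lborel (\<lambda>x. x ^ r * bspline t k j x)
    ((t (j + int k + 1) - t j) * (fact k * fact r / fact (r + k + 1))
      * divdiff t (\<lambda>x. x ^ (r + k + 1)) (Suc k) j)"
proof (induction k arbitrary: j r)
  case 0
  show ?case
    using bspline_moment_base[OF assms, of r j] by simp
next
  case (Suc k)
  define I where "I r j = (t (j + int k + 1) - t j) * (fact k * fact r / fact (r + k + 1))
      * divdiff t (\<lambda>x. x ^ (r + k + 1)) (Suc k) j" for r j
  define A where "A = t (j + int k + 1) - t j"
  define B where "B = t (j + int k + 2) - t (j + 1)"
  define E where "E = t (j + int k + 2) - t j"
  have pos: "A > 0" "B > 0" "E > 0"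
    unfolding A_def B_def E_def using assms by (auto intro!: strict_monoD[of t])
  have IH: "has_bochner_integral lborel (\<lambda>x. x ^ r * bspline t k j x) (I r j)" for r j
    unfolding I_def by (rule Suc.IH)
  have "has_bochner_integral lborel
     (\<lambda>x. (x ^ Suc r * bspline t k j x - t j * (x ^ r * bspline t k j x)) / A
        + (t (j + int k + 2) * (x ^ r * bspline t k (j + 1) x)
             - x ^ Suc r * bspline t k (j + 1) x) / B)
     ((I (Suc r) j - t j * I r j) / A
        + (t (j + int k + 2) * I r (j + 1) - I (Suc r) (j + 1)) / B)"
    by (intro has_bochner_integral_add has_bochner_integral_diff has_bochner_integral_divide
         has_bochner_integral_mult_right IH)
  also have "(\<lambda>x. (x ^ Suc r * bspline t k j x - t j * (x ^ r * bspline t k j x)) / A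
        + (t (j + int k + 2) * (x ^ r * bspline t k (j + 1) x)
             - x ^ Suc r * bspline t k (j + 1) x) / B)
     = (\<lambda>x. x ^ r * bspline t (Suc k) j x)"
    unfolding bspline.simps A_def[symmetric] B_def[symmetric]
    using pos by (intro ext) (simp add: field_simps)
  also have "(I (Suc r) j - t j * I r j) / A
        + (t (j + int k + 2) * I r (j + 1) - I (Suc r) (j + 1)) / B
     = (t (j + int (Suc k) + 1) - t j) * (fact (Suc k) * fact r / fact (r + Suc k + 1))
      * divdiff t (\<lambda>x. x ^ (r + Suc k + 1)) (Suc (Suc k)) j"
  proof -
    let ?n = "r + k + 1"
    define D1 where "D1 = divdiff t (\<lambda>x. x ^ Suc ?n) (Suc k) j"
    define D2 where "D2 = divdiff t (\<lambda>x. x ^ Suc ?n) (Suc k) (j + 1)"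
    define d1 where "d1 = divdiff t (\<lambda>x. x ^ ?n) (Suc k) j"
    define d2 where "d2 = divdiff t (\<lambda>x. x ^ ?n) (Suc k) (j + 1)"
    define D where "D = divdiff t (\<lambda>x. x ^ Suc ?n) (Suc (Suc k)) j"
    define d where "d = divdiff t (\<lambda>x. x ^ ?n) (Suc (Suc k)) j"
    define u where "u = t j"
    define v where "v = t (j + int k + 2)"
    define g where "g = (fact k * fact r / fact (r + k + 1) :: real)"
    define h where "h = g * real (r + 1) / real (r + k + 2)"
    have idx: "j + int (Suc k) + 1 = j + int k + 2" "j + 1 + int k + 1 = j + int k + 2"
      by simp_all
    have g: "fact k * fact (Suc r) / fact (Suc r + k + 1) = g * real (r + 1) / real (r + k + 2)"
      "fact (Suc k) * fact r / fact (r + Suc k + 1) = g * real (k + 1) / real (r + k + 2)"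
      by (simp_all add: g_def field_simps)
    have Ieq: "I (Suc r) j / A = g * real (r + 1) / real (r + k + 2) * D1"
      "I r j / A = g * d1"
      "I (Suc r) (j + 1) / B = g * real (r + 1) / real (r + k + 2) * D2"
      "I r (j + 1) / B = g * d2"
      using pos unfolding I_def g g_def[symmetric] idx A_def[symmetric] B_def[symmetric]
        D1_def D2_def d1_def d2_def by simp_all
    have 1: "D = u * d + d2"
      using divdiff_mult_x_first[OF assms, of "\<lambda>x. x ^ ?n" "Suc k" j]
      by (simp only: D_def d_def d2_def u_def power_Suc)
    have 2: "D = v * d + d1"
      using divdiff_mult_x_last[OF assms, of "\<lambda>x. x ^ ?n" "Suc k" j]
      by (simp only: D_def d_def d1_def v_def power_Suc idx)
    have 3: "D2 - D1 = E * D"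
      using pos unfolding D_def D2_def D1_def divdiff.simps(2)[of t _ "Suc k" j] idx E_def[symmetric]
      by simp
    have E: "E = v - u"
      by (simp add: E_def v_def u_def)
    \<comment> \<open>Eliminating \<open>d\<close> from the two forms of the Leibniz rule.\<close>
    have 4: "v * d2 - u * d1 = E * D"
    proof -
      have "d2 = D - u * d" "d1 = D - v * d"
        using 1 2 by simp_all
      then have "v * d2 - u * d1 = v * (D - u * d) - u * (D - v * d)"
        by simp
      then show ?thesis
        unfolding E by (simp add: algebra_simps)
    qed
    have "(I (Suc r) j - t j * I r j) / A
        + (t (j + int k + 2) * I r (j + 1) - I (Suc r) (j + 1)) / B
      = I (Suc r) j / A - u * (I r j / A) + (v * (I r (j + 1) / B) - I (Suc r) (j + 1) / B)"
      by (simp add: u_def v_def diff_divide_distrib)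
    also have "\<dots> = g * (v * d2 - u * d1) - h * (D2 - D1)"
      unfolding Ieq h_def[symmetric] by (simp add: algebra_simps)
    also have "\<dots> = E * (g * real (k + 1) / real (r + k + 2)) * D"
      unfolding 3 4 h_def by (simp add: field_simps)
    finally show ?thesis
      unfolding g idx E_def D_def by simp
  qed
  finally show ?case .
qed

lemma moment_eq_divdiff:
  assumes "strict_mono t" "m \<ge> 2"
  shows "moment t m r j = fact (m - 1) * fact r / fact (r + m - 1)
    * divdiff t (\<lambda>x. x ^ (r + m - 1)) (m - 1) (j - int m + 1)"
proof -
  obtain k where m: "m = k + 2"
    using assms(2) by (metis add.commute le_Suc_ex)
  define l where "l = j - int m + 1"
  define E where "E = t (l + int k + 1) - t l"
  have E: "E > 0"
    unfolding E_def using assms by (auto intro!: strict_monoD[of t])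
  have mom: "(LINT x|lborel. x ^ r * bspline t k l x)
      = E * (fact k * fact r / fact (r + k + 1)) * divdiff t (\<lambda>x. x ^ (r + k + 1)) (Suc k) l" for r
    using bspline_moment[OF assms(1), of r k l] unfolding E_def
    by (rule has_bochner_integral_integral_eq)
  have int: "(LINT x|lborel. bspline t k l x) = E / real (k + 1)"
    using mom[of 0] divdiff_power_same[OF assms(1), of "Suc k" l]
    by (simp add: field_simps del: divdiff.simps power_Suc of_nat_Suc)
  have "moment t m r j = (LINT x|lborel. x ^ r * bspline t k l x) / (E / real (k + 1))"
    unfolding moment_def M_spline_def l_def[symmetric] times_divide_eq_right
      integral_divide_zero
    by (simp add: m int)
  also have "\<dots> = fact (Suc k) * fact r / fact (r + k + 1)
      * divdiff t (\<lambda>x. x ^ (r + k + 1)) (Suc k) l"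
  proof -
    have "fact (Suc k) = real (k + 1) * fact k"
      by simp
    then show ?thesis
      unfolding mom using E by (simp del: divdiff.simps fact_Suc)
  qed
  finally show ?thesis
    by (simp add: m l_def)
qed

section \<open>The constraints are solvable\<close>

lemma W_rows_independent:
  assumes "strict_mono t" "2 \<le> m" "q \<le> m" "m \<le> 2 * p"
    and zero: "\<And>s. s \<in> {- int p..int p} \<Longrightarrow> (\<Sum>r\<le>q. c r * W t m i r s) = 0"
    and "r \<le> q"
  shows "c r = 0"
proof -
  define e where "e r = c r * (fact (m - 1) * fact r / fact (r + m - 1))" for r
  \<comment> \<open>The coefficients absorb the factors between moments and divided differences, so that the
    divided differences of \<open>F\<close> are the entries of the combination of rows.\<close>
  define F where "F = (\<Sum>r\<le>q. monom (e r) (r + m - 1))"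
  have poly_F: "poly F x = (\<Sum>r\<le>q. e r * x ^ (r + m - 1))" for x
    by (simp add: F_def poly_sum poly_monom)
  \<comment> \<open>The index of the first knot of the leftmost spline, which is \<open>M_spline t m (i - int p)\<close>.\<close>
  define a where "a = i - int p - int m + 1"
  have dd: "divdiff t (poly F) (m - 1) j = 0" if "a \<le> j" "j < a + int (2 * p + 1)" for j
  proof -
    define s where "s = j - i + int m - 1"
    have s: "s \<in> {- int p..int p}" and j: "j = i + s - int m + 1"
      using that by (auto simp: s_def a_def)
    have "divdiff t (poly F) (m - 1) j
        = (\<Sum>r\<le>q. e r * divdiff t (\<lambda>x. x ^ (r + m - 1)) (m - 1) j)"
      unfolding poly_F divdiff_sum ..
    also have "\<dots> = (\<Sum>r\<le>q. c r * W t m i r s)"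
      unfolding W_def moment_eq_divdiff[OF assms(1,2)] e_def j by (simp add: mult.assoc)
    finally show ?thesis
      using zero[OF s] by simp
  qed
  obtain L where L: "\<forall>k\<ge>m - 1. coeff L k = 0"
    "\<forall>j. a \<le> j \<longrightarrow> j < a + int (2 * p + 1 + (m - 1)) \<longrightarrow> poly F (t j) = poly L (t j)"
    using divdiff_zero_imp_poly[OF assms(1) dd] by blast
  have coeff_F: "coeff F k = (\<Sum>r\<le>q. if r + m - 1 = k then e r else 0)" for k
    by (simp add: F_def coeff_sum)
  have "F = L"
  proof (rule poly_eqI_degree)
    show "poly F x = poly L x" if "x \<in> t ` {a..<a + int (2 * p + m)}" for x
      using L(2) that assms(2) by auto
    have card: "card (t ` {a..<a + int (2 * p + m)}) = 2 * p + m"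
      using strict_mono_imp_inj_on[OF assms(1)] by (subst card_image) (auto intro: inj_on_subset)
    have "degree F \<le> q + m - 1"
      by (rule degree_le) (use assms(2) in \<open>auto simp: coeff_F intro!: sum.neutral\<close>)
    then show "degree F < card (t ` {a..<a + int (2 * p + m)})"
      using card assms by simp
    have "degree L \<le> m - 1"
      by (rule degree_le) (use L(1) in auto)
    then show "degree L < card (t ` {a..<a + int (2 * p + m)})"
      using card assms by simp
  qed
  moreover have "coeff F (r + m - 1) = (\<Sum>r'\<le>q. if r' = r then e r' else 0)"
    unfolding coeff_F using assms(2) by (intro sum.cong) auto
  then have "coeff F (r + m - 1) = e r"
    using \<open>r \<le> q\<close> by simp
  moreover have "coeff L (r + m - 1) = 0"
    using L(1) assms(2) by auto
  ultimately show ?thesis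
    by (simp add: e_def)
qed

text \<open>Linearly independent rows make a linear map surjective. Given a dual family \<open>e\<close> for the
  rows in \<open>R\<close>, the vectors \<open>a - (\<Sum>r\<in>R. (w r \<bullet> a) e r)\<close> lie in the common kernel of these rows,
  so if a further row vanished on that kernel it would be a combination of the rows in \<open>R\<close>.\<close>

lemma independent_rows_imp_solvable:
  fixes w :: "'r \<Rightarrow> 's \<Rightarrow> real"
  assumes "finite R" "finite S"
    and "\<And>c. (\<And>s. s \<in> S \<Longrightarrow> (\<Sum>r\<in>R. c r * w r s) = 0) \<Longrightarrow> \<forall>r\<in>R. c r = 0"
  shows "\<exists>a. \<forall>r\<in>R. (\<Sum>s\<in>S. w r s * a s) = b r"
  using assms(1,3)
proof (induction R arbitrary: b rule: finite_induct)
  case (insert x R)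
  define ap where "ap r a = (\<Sum>s\<in>S. w r s * a s)" for r a
  have ap_add: "ap r (\<lambda>s. a s + y * a' s) = ap r a + y * ap r a'" for r a a' y
    by (simp add: ap_def sum.distrib sum_distrib_left algebra_simps)
  have ap_sum: "ap r (\<lambda>s. a s - (\<Sum>k\<in>R. y k * e k s)) = ap r a - (\<Sum>k\<in>R. y k * ap r (e k))"
    for r a y and e :: "'r \<Rightarrow> 's \<Rightarrow> real"
  proof -
    have "(\<Sum>s\<in>S. w r s * (\<Sum>k\<in>R. y k * e k s)) = (\<Sum>k\<in>R. y k * (\<Sum>s\<in>S. w r s * e k s))"
      by (simp add: sum_distrib_left sum.swap[of _ R S] ac_simps)
    then show ?thesis
      by (simp add: ap_def right_diff_distrib sum_subtractf)
  qed
  have IH: "\<exists>a. \<forall>r\<in>R. ap r a = b r" for b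
    unfolding ap_def
  proof (rule insert.IH)
    \<comment> \<open>A relation among the rows in \<open>R\<close> extends by the coefficient \<open>0\<close> at \<open>x\<close>.\<close>
    fix c assume c: "\<And>s. s \<in> S \<Longrightarrow> (\<Sum>r\<in>R. c r * w r s) = 0"
    have "\<forall>r\<in>insert x R. (c(x := 0)) r = 0"
    proof (rule insert.prems)
      fix s assume "s \<in> S"
      have "(\<Sum>r\<in>R. (c(x := 0)) r * w r s) = (\<Sum>r\<in>R. c r * w r s)"
        using insert.hyps by (intro sum.cong) auto
      then show "(\<Sum>r\<in>insert x R. (c(x := 0)) r * w r s) = 0"
        using c[OF \<open>s \<in> S\<close>] insert.hyps by simp
    qed
    then show "\<forall>r\<in>R. c r = 0"
      using insert.hyps by (metis fun_upd_apply insertCI)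
  qed
  have "\<exists>z. (\<forall>r\<in>R. ap r z = 0) \<and> ap x z \<noteq> 0"
  proof (rule ccontr)
    assume "\<nexists>z. (\<forall>r\<in>R. ap r z = 0) \<and> ap x z \<noteq> 0"
    then have ker: "ap x z = 0" if "\<And>r. r \<in> R \<Longrightarrow> ap r z = 0" for z
      using that by blast
    have "\<forall>k. \<exists>a. \<forall>r\<in>R. ap r a = (if r = k then 1 else 0)"
      by (intro allI IH)
    then obtain e where e: "\<And>k r. r \<in> R \<Longrightarrow> ap r (e k) = (if r = k then 1 else 0)"
      by metis
    define c where "c r = (if r = x then - 1 else ap x (e r))" for r
    have "\<forall>r\<in>insert x R. c r = 0"
    proof (rule insert.prems)
      fix s assume s: "s \<in> S"
      \<comment> \<open>The unit vector at \<open>s\<close>, corrected by the dual family, lies in the kernel.\<close>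
      define u where "u = (\<lambda>s'. if s' = s then 1 else 0 :: real)"
      have u: "ap r u = w r s" for r
        using s \<open>finite S\<close> by (simp add: ap_def u_def if_distrib[of "(*) _"] cong: if_cong)
      have "ap x (\<lambda>s'. u s' - (\<Sum>k\<in>R. w k s * e k s')) = 0"
      proof (rule ker)
        fix r assume r: "r \<in> R"
        then have "(\<Sum>k\<in>R. w k s * ap r (e k)) = w r s"
          using \<open>finite R\<close> by (simp add: e if_distrib[of "(*) _"] cong: if_cong)
        then show "ap r (\<lambda>s'. u s' - (\<Sum>k\<in>R. w k s * e k s')) = 0"
          by (simp add: ap_sum u)
      qed
      then have "w x s = (\<Sum>k\<in>R. w k s * ap x (e k))"
        by (simp add: ap_sum u)
      also have "\<dots> = (\<Sum>k\<in>R. c k * w k s)"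
        using insert.hyps by (intro sum.cong) (auto simp: c_def)
      finally show "(\<Sum>r\<in>insert x R. c r * w r s) = 0"
        using insert.hyps by (simp add: c_def)
    qed
    then show False
      by (simp add: c_def)
  qed
  then obtain z where z: "\<And>r. r \<in> R \<Longrightarrow> ap r z = 0" "ap x z \<noteq> 0"
    by blast
  obtain a where a: "\<And>r. r \<in> R \<Longrightarrow> ap r a = b r"
    using IH by blast
  define y where "y = (b x - ap x a) / ap x z"
  have "\<forall>r\<in>insert x R. ap r (\<lambda>s. a s + y * z s) = b r"
    unfolding ap_add using z a by (auto simp: y_def)
  then show ?case
    unfolding ap_def by (rule exI[of _ "\<lambda>s. a s + y * z s"])
qed simp

lemma feasible_nonempty:
  assumes "strict_mono t" "2 \<le> m" "q \<le> m" "m \<le> 2 * p"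
  shows "feasible t m p q i \<noteq> {}"
proof -
  have "\<exists>a. \<forall>r\<in>{..q}. (\<Sum>s\<in>{- int p..int p}. W t m i r s * a s) = theta t m r i"
    by (rule independent_rows_imp_solvable) (use W_rows_independent[OF assms] in auto)
  then obtain a where a: "\<And>r. r \<le> q \<Longrightarrow> (\<Sum>s\<in>{- int p..int p}. W t m i r s * a s) = theta t m r i"
    by auto
  have "restrict a {- int p..int p} \<in> feasible t m p q i"
    using a by (simp add: feasible_def vecs_def)
  then show ?thesis
    by blast
qed

section \<open>Existence of a minimizer\<close>

lemma minimizer_exists:
  assumes "feasible t m p q i \<noteq> {}"
  shows "\<exists>a. minimizer t m p q i a"
proof -
  let ?S = "{- int p..int p}"
  let ?F = "feasible t m p q i"
  obtain a0 where a0: "a0 \<in> ?F"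
    using assms by blast
  \<comment> \<open>The topology is the product topology on all functions. Extensional vectors with entries
    in \<open>{- N..N}\<close> form a compact product, whose factors off the index range are singletons.\<close>
  define N where "N = norm1 p a0"
  define X where "X s = (if s \<in> ?S then {- N..N} else {undefined})" for s
  define K where "K = Pi\<^sub>E UNIV X"
  have "compactin (product_topology (\<lambda>_. euclidean) UNIV) K"
    unfolding K_def compactin_PiE by (auto simp: X_def)
  then have "compact K"
    by (simp add: euclidean_product_topology)
  have cont: "continuous_on UNIV (\<lambda>a :: int \<Rightarrow> real. a s)" for s
    by (rule continuous_on_product_coordinates)
  define Z where "Z = {a. \<forall>r\<le>q. (\<Sum>s\<in>?S. W t m i r s * a s) = theta t m r i}"
  have "closed Z"
    unfolding Z_def by (intro closed_Collect_all closed_Collect_imp open_Collect_const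
        closed_Collect_eq        continuous_on_sum continuous_on_mult cont continuous_intros)
  have in_K: "a \<in> K" if "a \<in> ?F" "norm1 p a \<le> N" for a
  proof -
    have "\<bar>a s\<bar> \<le> N" if "s \<in> ?S" for s
      using member_le_sum[OF that, of "\<lambda>s. \<bar>a s\<bar>"] \<open>norm1 p a \<le> N\<close> by (auto simp: norm1_def)
    moreover have "a s = undefined" if "s \<notin> ?S" for s
      using \<open>a \<in> ?F\<close> that unfolding feasible_def vecs_def by (auto dest: PiE_arb)
    ultimately show ?thesis
      unfolding K_def X_def by (auto simp: abs_le_iff minus_le_iff)
  qed
  have K_F: "K \<inter> Z \<subseteq> ?F"
    unfolding K_def Z_def feasible_def vecs_def X_def
    by (auto simp: PiE_iff extensional_def split: if_splits)
  have F_Z: "?F \<subseteq> Z"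
    by (auto simp: Z_def feasible_def)
  have "compact (K \<inter> Z)"
    using \<open>compact K\<close> \<open>closed Z\<close> by (rule compact_Int_closed)
  moreover have "a0 \<in> K \<inter> Z"
    using in_K[OF a0] a0 F_Z by (auto simp: N_def)
  moreover have "continuous_on (K \<inter> Z) (norm1 p)"
    unfolding norm1_def
    by (intro continuous_on_sum continuous_on_rabs continuous_on_subset[OF cont]) auto
  ultimately obtain a where a: "a \<in> K \<inter> Z" "\<And>b. b \<in> K \<inter> Z \<Longrightarrow> norm1 p a \<le> norm1 p b"
    using continuous_attains_inf[of "K \<inter> Z" "norm1 p"] by blast
  have "norm1 p a \<le> norm1 p b" if "b \<in> ?F" for b
  proof (cases "norm1 p b \<le> N")
    case True
    then show ?thesis
      using a(2)[of b] in_K[OF that] that F_Z by auto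
  next
    case False
    then show ?thesis
      using a(2)[OF \<open>a0 \<in> K \<inter> Z\<close>] by (simp add: N_def)
  qed
  then have "minimizer t m p q i a"
    using a(1) K_F by (auto simp: minimizer_def is_arg_min_linorder)
  then show ?thesis
    by (rule exI[of _ a])
qed

section \<open>Non-uniqueness\<close>

lemma feasible_0:
  assumes "strict_mono t" "2 \<le> m"
  shows "feasible t m p 0 i = {a \<in> vecs p. (\<Sum>s\<in>{- int p..int p}. a s) = 1}"
proof -
  have "W t m i 0 s = 1" for s
    unfolding W_def moment_eq_divdiff[OF assms] by (simp add: divdiff_power_same[OF assms(1)])
  moreover have "{S. S \<subseteq> {i - int m + 1..i} \<and> card S = 0} = {{}}"
    by (auto dest: finite_subset)
  then have "theta t m 0 i = 1"
    by (simp add: theta_def elem_sym_def)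
  ultimately show ?thesis
    by (simp add: feasible_def)
qed

lemma minimizer_unit_vector:
  assumes "strict_mono t" "2 \<le> m" "k \<in> {- int p..int p}"
  shows "minimizer t m p 0 i (\<lambda>s\<in>{- int p..int p}. if s = k then 1 else 0)" (is "minimizer _ _ _ _ _ ?a")
proof -
  have "norm1 p ?a = 1"
    using assms(3) by (simp add: norm1_def if_distrib[of abs] cong: if_cong)
  moreover have "1 \<le> norm1 p b" if "(\<Sum>s\<in>{- int p..int p}. b s) = 1" for b
    using sum_abs[of b "{- int p..int p}"] that by (simp add: norm1_def)
  moreover have "(\<Sum>s\<in>{- int p..int p}. ?a s) = 1"
    using assms(3) by simp
  ultimately show ?thesis
    unfolding minimizer_def feasible_0[OF assms(1,2)] is_arg_min_linorder
    by (auto simp: vecs_def)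
qed

lemma knot_sequence_of_int: "knot_sequence real_of_int"
proof -
  have "filterlim (\<lambda>i. real_of_int \<bar>i\<bar>) at_top (filtercomap abs at_top)"
    by (rule filterlim_compose[OF filterlim_real_of_int_at_top filterlim_filtercomap])
  then show ?thesis
    by (simp add: knot_sequence_def strict_mono_def)
qed

theorem theorem7:
  "(\<forall>(m::nat) (p::nat) (q::nat) (t::int \<Rightarrow> real).
      2 \<le> m \<and> q \<le> m \<and> m \<le> 2 * p \<and> knot_sequence t \<longrightarrow>
      (\<forall>i::int. \<exists>a. minimizer t m p q i a)) \<and>
   (\<exists>(m::nat) (p::nat) (q::nat) (t::int \<Rightarrow> real) (i::int).
      2 \<le> m \<and> q \<le> m \<and> m \<le> 2 * p \<and> knot_sequence t \<and>
      (\<exists>a a'. minimizer t m p q i a \<and> minimizer t m p q i a' \<and> a \<noteq> a'))"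
proof (intro conjI allI impI)
  fix m p q :: nat and t :: "int \<Rightarrow> real" and i :: int
  assume "2 \<le> m \<and> q \<le> m \<and> m \<le> 2 * p \<and> knot_sequence t"
  then show "\<exists>a. minimizer t m p q i a"
    by (intro minimizer_exists feasible_nonempty) (auto simp: knot_sequence_def)
next
  define e where "e k = (\<lambda>s\<in>{- int 1..int 1}. if s = k then 1 else 0 :: real)" for k
  have "strict_mono real_of_int"
    by (simp add: strict_mono_def)
  then have "minimizer real_of_int 2 1 0 0 (e 0)" "minimizer real_of_int 2 1 0 0 (e 1)"
    unfolding e_def by (intro minimizer_unit_vector; simp)+
  moreover have "e 0 0 \<noteq> e 1 0"
    by (simp add: e_def)
  then have "e 0 \<noteq> e 1"
    by metis
  ultimately show "\<exists>(m::nat) (p::nat) (q::nat) (t::int \<Rightarrow> real) (i::int).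
      2 \<le> m \<and> q \<le> m \<and> m \<le> 2 * p \<and> knot_sequence t \<and>
      (\<exists>a a'. minimizer t m p q i a \<and> minimizer t m p q i a' \<and> a \<noteq> a')"
    using knot_sequence_of_int
    by (intro exI[of _ 2] exI[of _ 1] exI[of _ 0] exI[of _ real_of_int] exI[of _ "0::int"]) auto
qed

end
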